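(* Let $T$ be a rank-one transformation with height sets $(H_n)_{n}$ and let $0<\rho\le 1$. If there are a sequence of indices $n_m\to\infty$ and a corresponding sequence $(a_{n_m})$ of positive integers such that $$\lim_{m\to\infty}\frac{\left|(a_{n_m}+H_{n_m})\cap H_{n_m}\right|}{\left|H_{n_m}\right|}=\rho,$$ then $T$ is at least $\rho$-partially rigid.
   Context: A column is an ordered finite collection of pairwise disjoint intervals in $\mathbb R$ of equal length (its levels), thought of as stacked, with heights indexed from $0$; its column map $T_C$ sends each point of a level other than the top one to the point directly above it in the next level. A rank-one (cutting-and-stacking) transformation $T$ is given by columns $C_0,C_1,C_2,\dots$ as follows: $C_0$ is the single level consisting of the unit interval; $C_{n+1}$ is obtained from $C_n$ by cutting $C_n$ into $r_n\ge 2$ subcolumns of equal width, numbered $0,\dots,r_n-1$ from left to right, adding $s_{n,k}\ge 0$ new levels (spacers: intervals of the same length as the subcolumn levels, disjoint from $C_n$ and from each other) above the $k$-th subcolumn, and stacking each subcolumn (with its spacers) under the subcolumn to its right. $X$ is the union of all levels of all columns, $\mu$ is Lebesgue measure on $X$, and $T$ is the pointwise limit of the $T_{C_n}$; it is an invertible (mod null sets) measure-preserving transformation. It is assumed that $\mu(X)=\infty$. Let $h_n$ be the number of levels of $C_n$. The $n$-th height set is $$H_n=\{0\}\cup\Big\{\sum_{k=0}^{\ell}(h_n+s_{n,k}) : 0\le \ell<r_n-1\Big\},$$ so $|H_n|=r_n$. For $0<\rho\le 1$, $T$ is at least $\rho$-partially rigid if for every measurable set $A$ of finite measure there is a sequence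 of integers $q_m\to\infty$ with $\lim_{m\to\infty}\mu(A\cap T^{q_m}A)\ge\rho\,\mu(A)$. For an integer $a$ and a set $H$ of integers, $a+H=\{a+h: h\in H\}$. *)

theory Defs
  imports "HOL-Analysis.Analysis"
begin

text \<open>Levels are taken half-open, so that cutting a level partitions it exactly. A column is
  stored as the common length of its levels and the left endpoints of the levels, bottom to top.\<close>

datatype column = Column (width: real) (left_ends: "real list")

definition height :: "column \<Rightarrow> nat" where
  "height C = length (left_ends C)"

definition level :: "column \<Rightarrow> nat \<Rightarrow> real set" where
  "level C i = {left_ends C ! i ..< left_ends C ! i + width C}"

definition is_column :: "column \<Rightarrow> bool" where
  "is_column C \<longleftrightarrow> width C > 0 \<and> disjoint_family_on (level C) {..<height C}"

text \<open>The value outside the non-top levels is a dummy value.\<close>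

definition column_map :: "column \<Rightarrow> real \<Rightarrow> real" where
  "column_map C x =
    (if \<exists>i. Suc i < height C \<and> x \<in> level C i
     then let i = (THE i. Suc i < height C \<and> x \<in> level C i)
          in x - left_ends C ! i + left_ends C ! Suc i
     else x)"

text \<open>The list \<open>sp k\<close> holds the left endpoints of the spacers put above subcolumn \<open>k\<close>.\<close>

definition subcolumn_ends :: "column \<Rightarrow> nat \<Rightarrow> nat \<Rightarrow> real list" where
  "subcolumn_ends C r k = map (\<lambda>x. x + real k * (width C / real r)) (left_ends C)"

definition cut_and_stack :: "column \<Rightarrow> nat \<Rightarrow> (nat \<Rightarrow> real list) \<Rightarrow> column" where
  "cut_and_stack C r sp =
    Column (width C / real r) (concat (map (\<lambda>k. subcolumn_ends C r k @ sp k) [0..<r]))"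

text \<open>Since the levels of \<open>C (Suc n)\<close> are the cut levels of \<open>C n\<close> together with the spacers,
  the condition \<open>is_column (C (Suc n))\<close> says that the spacers are disjoint from \<open>C n\<close> and from
  each other. The positions of the spacers on the line are otherwise arbitrary.\<close>

locale rank_one =
  fixes r :: "nat \<Rightarrow> nat" and s :: "nat \<Rightarrow> nat \<Rightarrow> nat" and C :: "nat \<Rightarrow> column"
  assumes C_0: "C 0 = Column 1 [0]"
    and cuts: "\<And>n. r n \<ge> 2"
    and C_Suc: "\<And>n. \<exists>sp. (\<forall>k<r n. length (sp k) = s n k) \<and> C (Suc n) = cut_and_stack (C n) (r n) sp"
    and columns: "\<And>n. is_column (C n)"

definition rank_one_space :: "(nat \<Rightarrow> column) \<Rightarrow> real set" where
  "rank_one_space C = (\<Union>n. \<Union>i<height (C n). level (C n) i)"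

text \<open>Each column map extends the previous one, and every point of the space lies in a non-top
  level of \<open>C n\<close> for all large \<open>n\<close>: a point that stayed in the top levels would lie in
  half-open intervals with a common right endpoint and lengths tending to 0. So on the space the
  limit is that of an eventually constant sequence, unaffected by the dummy values.\<close>

definition rank_one_map :: "(nat \<Rightarrow> column) \<Rightarrow> real \<Rightarrow> real" where
  "rank_one_map C x = lim (\<lambda>n. column_map (C n) x)"

definition height_set :: "(nat \<Rightarrow> nat) \<Rightarrow> (nat \<Rightarrow> nat \<Rightarrow> nat) \<Rightarrow> (nat \<Rightarrow> column) \<Rightarrow> nat \<Rightarrow> int set" where
  "height_set r s C n =
    {0} \<union> {(\<Sum>k=0..l. int (height (C n)) + int (s n k)) | l. l < r n - 1}"

text \<open>The set \<open>T\<^sup>q A\<close> for an integer \<open>q\<close>; negative powers are preimages, as \<open>T\<close> need be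
  invertible only up to null sets.\<close>

definition power_image :: "'a measure \<Rightarrow> ('a \<Rightarrow> 'a) \<Rightarrow> int \<Rightarrow> 'a set \<Rightarrow> 'a set" where
  "power_image M T q A =
    (if 0 \<le> q then (T ^^ nat q) ` A else (T ^^ nat (- q)) -` A \<inter> space M)"

definition at_least_partially_rigid :: "'a measure \<Rightarrow> ('a \<Rightarrow> 'a) \<Rightarrow> real \<Rightarrow> bool" where
  "at_least_partially_rigid M T \<rho> \<longleftrightarrow>
    (\<forall>A\<in>sets M. emeasure M A < \<infinity> \<longrightarrow>
      (\<exists>q :: nat \<Rightarrow> int. filterlim q at_top sequentially \<and>
        (\<exists>L. (\<lambda>m. measure M (A \<inter> power_image M T (q m) A)) \<longlonglongrightarrow> L \<and> L \<ge> \<rho> * measure M A)))"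

end

theory Submission
  imports Defs
begin

text \<open>
  A set \<open>A\<close> of finite measure is approximated by unions \<open>B\<^sub>n\<close> of levels of \<open>C n\<close>, namely of those
  contained in an open set slightly larger than \<open>A\<close>. A level of \<open>C n\<close> is cut into \<open>r n\<close> pieces
  sitting in \<open>C (Suc n)\<close> at heights differing by the elements of \<open>H\<^sub>n\<close>, and \<open>T\<^sup>a\<close> moves each piece
  whose height remains in \<open>H\<^sub>n\<close> after adding \<open>a\<close> onto another piece of the same level. So
  \<open>\<mu> (B\<^sub>n \<inter> T\<^sup>a B\<^sub>n) \<ge> \<mu> B\<^sub>n \<cdot> |(a + H\<^sub>n) \<inter> H\<^sub>n| / |H\<^sub>n|\<close>, and since images under \<open>T\<close> do not increase
  measure, replacing \<open>B\<^sub>n\<close> by \<open>A\<close> costs at most \<open>2 \<mu> (B\<^sub>n - A)\<close>. Distinct elements of \<open>H\<^sub>n\<close> differ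
  by at least the height of \<open>C n\<close>, which forces \<open>a \<rightarrow> \<infinity>\<close>.
\<close>

section \<open>Maps whose images do not increase measure\<close>

definition measure_nonexpanding :: "'a measure \<Rightarrow> ('a \<Rightarrow> 'a) \<Rightarrow> bool" where
  "measure_nonexpanding M f \<longleftrightarrow> (\<forall>A\<in>sets M. f ` A \<in> sets M \<and> emeasure M (f ` A) \<le> emeasure M A)"

lemma measure_nonexpanding_funpow:
  assumes "measure_nonexpanding M f"
  shows "measure_nonexpanding M (f ^^ q)"
  unfolding measure_nonexpanding_def
proof
  fix A assume "A \<in> sets M"
  then show "(f ^^ q) ` A \<in> sets M \<and> emeasure M ((f ^^ q) ` A) \<le> emeasure M A"
  proof (induction q)
    case (Suc q)
    have "(f ^^ Suc q) ` A = f ` (f ^^ q) ` A" by (simp add: image_comp)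
    then show ?case
      using Suc assms unfolding measure_nonexpanding_def by (metis order_trans)
  qed simp
qed

lemma
  assumes "measure_nonexpanding M f" "A \<in> fmeasurable M"
  shows measure_nonexpanding_image_fmeasurable: "f ` A \<in> fmeasurable M"
    and measure_nonexpanding_image_le: "measure M (f ` A) \<le> measure M A"
proof -
  have image: "f ` A \<in> sets M" "emeasure M (f ` A) \<le> emeasure M A"
    using assms by (auto simp: measure_nonexpanding_def fmeasurableD)
  have finite: "emeasure M A < \<infinity>"
    using assms(2) by (simp add: fmeasurable_def)
  show "f ` A \<in> fmeasurable M"
    using image finite by (auto intro: fmeasurableI le_less_trans)
  show "measure M (f ` A) \<le> measure M A"
    unfolding measure_def using image finite by (intro enn2real_mono) auto
qed

lemma measure_nonexpanding_incseq:
  assumes E: "incseq E" "\<And>n. E n \<in> sets M" "(\<Union>n. E n) = space M"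
    and f: "\<And>n A. A \<in> sets M \<Longrightarrow> A \<subseteq> E n \<Longrightarrow> f ` A \<in> sets M \<and> emeasure M (f ` A) \<le> emeasure M A"
  shows "measure_nonexpanding M f"
  unfolding measure_nonexpanding_def
proof
  fix A assume A: "A \<in> sets M"
  have image_eq: "f ` A = (\<Union>n. f ` (A \<inter> E n))"
    using E(3) sets.sets_into_space[OF A] by blast
  have piece: "f ` (A \<inter> E n) \<in> sets M" "emeasure M (f ` (A \<inter> E n)) \<le> emeasure M (A \<inter> E n)" for n
    using f[of "A \<inter> E n" n] A E(2) by auto
  have "emeasure M (f ` A) = (SUP n. emeasure M (f ` (A \<inter> E n)))"
    unfolding image_eq
  proof (rule SUP_emeasure_incseq[symmetric])
    show "incseq (\<lambda>n. f ` (A \<inter> E n))"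
      using E(1) by (fastforce simp: incseq_def)
  qed (use piece in auto)
  also have "\<dots> \<le> emeasure M A"
    using piece(2) A by (intro SUP_least) (meson Int_lower1 emeasure_mono order_trans)
  finally show "f ` A \<in> sets M \<and> emeasure M (f ` A) \<le> emeasure M A"
    unfolding image_eq using piece(1) by auto
qed

lemma
  fixes f :: "'a::euclidean_space \<Rightarrow> 'a"
  assumes E: "finite I" "disjoint_family_on E I" "\<And>i. i \<in> I \<Longrightarrow> E i \<in> sets lebesgue"
    and translation: "\<And>i x. i \<in> I \<Longrightarrow> x \<in> E i \<Longrightarrow> f x = c i + x"
  shows lebesgue_sets_image_piecewise_translation: "f ` (\<Union>i\<in>I. E i) \<in> sets lebesgue"
    and emeasure_lebesgue_image_piecewise_translation_le:
      "emeasure lebesgue (f ` (\<Union>i\<in>I. E i)) \<le> emeasure lebesgue (\<Union>i\<in>I. E i)"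
proof -
  have image_eq: "f ` E i = (+) (c i) ` E i" if "i \<in> I" for i
    using translation[OF that] by (intro image_cong) auto
  have sets: "f ` E i \<in> sets lebesgue" if "i \<in> I" for i
    unfolding image_eq[OF that] using E(3)[OF that] by (rule lebesgue_sets_translation)
  have emeasure: "emeasure lebesgue (f ` E i) = emeasure lebesgue (E i)" if "i \<in> I" for i
    using emeasure_lebesgue_affine[of 1 "c i" "E i"] unfolding image_eq[OF that]
    by (simp add: add.commute)
  show "f ` (\<Union>i\<in>I. E i) \<in> sets lebesgue"
    unfolding image_UN using E(1) sets by (intro sets.finite_UN) auto
  have "emeasure lebesgue (f ` (\<Union>i\<in>I. E i)) \<le> (\<Sum>i\<in>I. emeasure lebesgue (f ` E i))"
    unfolding image_UN using E(1) sets by (intro emeasure_subadditive_finite) auto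
  also have "\<dots> = (\<Sum>i\<in>I. emeasure lebesgue (E i))"
    by (intro sum.cong emeasure refl)
  also have "\<dots> = emeasure lebesgue (\<Union>i\<in>I. E i)"
    using E by (intro sum_emeasure) auto
  finally show "emeasure lebesgue (f ` (\<Union>i\<in>I. E i)) \<le> emeasure lebesgue (\<Union>i\<in>I. E i)" .
qed

section \<open>Partial rigidity from approximating sets\<close>

lemma Lim_measure_Int_incseq:
  assumes A: "A \<in> fmeasurable M" and B: "incseq B" "\<And>n. B n \<in> sets M" "A \<subseteq> (\<Union>n. B n)"
  shows "(\<lambda>n. measure M (A \<inter> B n)) \<longlonglongrightarrow> measure M A"
proof -
  have UN_eq: "(\<Union>n. A \<inter> B n) = A"
    using B(3) by blast
  have "(\<lambda>n. measure M (A \<inter> B n)) \<longlonglongrightarrow> measure M (\<Union>n. A \<inter> B n)"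
  proof (rule Lim_measure_incseq)
    show "range (\<lambda>n. A \<inter> B n) \<subseteq> sets M"
      using fmeasurableD[OF A] B(2) by blast
    show "incseq (\<lambda>n. A \<inter> B n)"
      using B(1) unfolding incseq_def by blast
    show "emeasure M (\<Union>n. A \<inter> B n) \<noteq> \<infinity>"
      unfolding UN_eq infinity_ennreal_def by (rule fmeasurableD2[OF A])
  qed
  then show ?thesis
    unfolding UN_eq .
qed

lemma measure_Int_image_le_approx:
  assumes f: "measure_nonexpanding M f" and A: "A \<in> fmeasurable M" and B: "B \<in> fmeasurable M"
  shows "measure M (B \<inter> f ` B) \<le> measure M (A \<inter> f ` A) + 2 * measure M (B - A)"
proof -
  have D: "B - A \<in> fmeasurable M"
    using A B by (simp add: fmeasurable.Diff)
  note image = measure_nonexpanding_image_fmeasurable[OF f]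
  have AA: "A \<inter> f ` A \<in> fmeasurable M"
    using A image by (simp add: fmeasurable.Int)
  have "measure M (B \<inter> f ` B) \<le> measure M ((A \<inter> f ` A) \<union> ((B - A) \<union> f ` (B - A)))"
    using AA B D image by (intro measure_mono_fmeasurable) (auto simp: fmeasurableD fmeasurable.Un)
  also have "\<dots> \<le> measure M (A \<inter> f ` A) + measure M ((B - A) \<union> f ` (B - A))"
    using AA D image by (intro measure_Un_le) (auto simp: fmeasurableD)
  also have "measure M ((B - A) \<union> f ` (B - A)) \<le> measure M (B - A) + measure M (f ` (B - A))"
    using D image by (intro measure_Un_le) (auto simp: fmeasurableD)
  also have "measure M (f ` (B - A)) \<le> measure M (B - A)"
    using f D by (rule measure_nonexpanding_image_le)
  finally show ?thesis by simp
qed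

lemma eventually_measure_Int_image_gt:
  assumes f: "\<And>m. measure_nonexpanding M (f m)"
    and A: "A \<in> fmeasurable M" and B: "\<And>m. B m \<in> fmeasurable M"
    and excess: "\<And>m. measure M (B m - A) \<le> \<epsilon>"
    and exhaust: "((\<lambda>m. measure M (A \<inter> B m)) \<longlongrightarrow> measure M A) F"
    and \<theta>: "(\<theta> \<longlongrightarrow> \<rho>) F" "\<And>m. 0 \<le> \<theta> m"
    and return: "\<And>m. \<theta> m * measure M (B m) \<le> measure M (B m \<inter> f m ` B m)"
    and less: "b + 2 * \<epsilon> < \<rho> * measure M A"
  shows "\<forall>\<^sub>F m in F. b < measure M (A \<inter> f m ` A)"
proof -
  have "\<forall>\<^sub>F m in F. b + 2 * \<epsilon> < \<theta> m * measure M (A \<inter> B m)"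
    using tendsto_mult[OF \<theta>(1) exhaust] less by (rule order_tendstoD(1))
  then show ?thesis
  proof eventually_elim
    case (elim m)
    also have "\<theta> m * measure M (A \<inter> B m) \<le> \<theta> m * measure M (B m)"
      using A B \<theta>(2) by (intro mult_left_mono measure_mono_fmeasurable) (auto simp: fmeasurableD)
    also have "\<dots> \<le> measure M (B m \<inter> f m ` B m)"
      by (rule return)
    also have "\<dots> \<le> measure M (A \<inter> f m ` A) + 2 * measure M (B m - A)"
      using f A B by (rule measure_Int_image_le_approx)
    finally show ?case
      using excess[of m] by linarith
  qed
qed

lemma at_least_partially_rigidI:
  fixes q :: "nat \<Rightarrow> int"
  assumes q: "filterlim q at_top sequentially"
    and return: "\<And>A b. A \<in> fmeasurable M \<Longrightarrow> b < \<rho> * measure M A \<Longrightarrow>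
      \<forall>\<^sub>F m in sequentially. b < measure M (A \<inter> power_image M T (q m) A)"
  shows "at_least_partially_rigid M T \<rho>"
  unfolding at_least_partially_rigid_def
proof (intro ballI impI)
  fix A assume sets: "A \<in> sets M" and finite: "emeasure M A < \<infinity>"
  define f where "f m = measure M (A \<inter> power_image M T (q m) A)" for m
  have "f m \<in> {0..measure M A}" for m
    unfolding f_def measure_def using sets finite by (auto intro!: enn2real_mono emeasure_mono)
  then obtain L \<sigma> where \<sigma>: "strict_mono \<sigma>" and L: "(f \<circ> \<sigma>) \<longlonglongrightarrow> L"
    using compact_Icc[of 0 "measure M A"] unfolding compact_def by metis
  have "\<rho> * measure M A \<le> L"
  proof (rule dense_le)
    fix b assume "b < \<rho> * measure M A"
    then have "\<forall>\<^sub>F m in sequentially. b < f m"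
      unfolding f_def using sets finite by (intro return fmeasurableI)
    from eventually_subseq[OF \<sigma> this] have "\<forall>\<^sub>F m in sequentially. b \<le> (f \<circ> \<sigma>) m"
      by (rule eventually_mono) simp
    with L show "b \<le> L" by (rule tendsto_lowerbound) simp
  qed
  moreover have "filterlim (q \<circ> \<sigma>) at_top sequentially"
    unfolding comp_def by (rule filterlim_compose[OF q filterlim_subseq[OF \<sigma>]])
  ultimately show "\<exists>q. filterlim q at_top sequentially \<and>
      (\<exists>L. (\<lambda>m. measure M (A \<inter> power_image M T (q m) A)) \<longlonglongrightarrow> L \<and> \<rho> * measure M A \<le> L)"
    using L by (auto simp: f_def comp_def intro!: exI[of _ "q \<circ> \<sigma>"])
qed

section \<open>Columns\<close>

abbreviation levels :: "column \<Rightarrow> nat set \<Rightarrow> real set" where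
  "levels C I \<equiv> (\<Union>i\<in>I. level C i)"

definition nontop :: "column \<Rightarrow> real set" where
  "nontop C = levels C {..<height C - 1}"

lemma in_nontop_iff: "x \<in> nontop C \<longleftrightarrow> (\<exists>i. Suc i < height C \<and> x \<in> level C i)"
  by (auto simp: nontop_def less_diff_conv)

lemma lmeasurable_level [simp]: "level C i \<in> lmeasurable"
  by (rule bounded_set_imp_lmeasurable)
    (auto simp: level_def intro: bounded_subset[OF bounded_closed_interval])

lemma sets_lebesgue_levels [simp]: "levels C I \<in> sets lebesgue"
  by (intro sets.countable_UN') (auto simp: fmeasurableD)

lemma lmeasurable_levels: "finite I \<Longrightarrow> levels C I \<in> lmeasurable"
  by (intro fmeasurable.finite_UN) auto

lemma level_eq_of_mem:
  assumes "is_column C" "x \<in> level C i" "x \<in> level C j" "i < height C" "j < height C"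
  shows "i = j"
  using assms unfolding is_column_def by (meson disjoint_family_onD disjoint_iff lessThan_iff)

lemma measure_levels:
  assumes "is_column C" "I \<subseteq> {..<height C}"
  shows "measure lebesgue (levels C I) = real (card I) * width C"
proof -
  have "measure lebesgue (levels C I) = (\<Sum>i\<in>I. measure lebesgue (level C i))"
  proof (rule measure_finite_Union)
    show "finite I"
      using assms(2) by (rule finite_subset) simp
    show "disjoint_family_on (level C) I"
      using assms by (auto simp: is_column_def intro: disjoint_family_on_mono)
  qed (use fmeasurableD2[OF lmeasurable_level] in \<open>auto simp: fmeasurableD\<close>)
  then show ?thesis
    using assms(1) by (simp add: level_def is_column_def)
qed

lemma column_map_level:
  assumes "is_column C" "x \<in> level C i" "Suc i < height C"
  shows "column_map C x = left_ends C ! Suc i - left_ends C ! i + x"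
proof -
  have "(THE i. Suc i < height C \<and> x \<in> level C i) = i"
    using assms level_eq_of_mem by (intro the_equality) (auto dest: Suc_lessD)
  then show ?thesis
    unfolding column_map_def using assms by (auto simp: Let_def)
qed

lemma column_map_image_level:
  assumes "is_column C" "Suc i < height C"
  shows "column_map C ` level C i = level C (Suc i)"
proof -
  have "column_map C ` level C i = (+) (left_ends C ! Suc i - left_ends C ! i) ` level C i"
    using assms by (intro image_cong) (auto simp: column_map_level)
  then show ?thesis
    by (simp add: level_def ac_simps)
qed

lemma column_map_image_nontop_subset:
  assumes "is_column C"
  shows "column_map C ` nontop C \<subseteq> levels C {..<height C}"
  unfolding nontop_def image_UN
proof (rule UN_least)
  fix i assume "i \<in> {..<height C - 1}"
  then have "Suc i < height C" by auto
  then show "column_map C ` level C i \<subseteq> levels C {..<height C}"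
    using column_map_image_level[OF assms] by blast
qed

lemma
  assumes C: "is_column C" and A: "A \<in> sets lebesgue" "A \<subseteq> nontop C"
  shows sets_lebesgue_column_map_image: "column_map C ` A \<in> sets lebesgue"
    and emeasure_lebesgue_column_map_image_le:
      "emeasure lebesgue (column_map C ` A) \<le> emeasure lebesgue A"
proof -
  define E where "E i = A \<inter> level C i" for i
  define c where "c i = left_ends C ! Suc i - left_ends C ! i" for i
  have A_eq: "(\<Union>i<height C - 1. E i) = A"
    using A(2) by (auto simp: nontop_def E_def)
  have disj: "disjoint_family_on E {..<height C - 1}"
    using C by (fastforce simp: is_column_def disjoint_family_on_def E_def)
  have E_sets: "E i \<in> sets lebesgue" for i
    using A(1) fmeasurableD[OF lmeasurable_level] by (auto simp: E_def)
  have translation: "column_map C x = c i + x" if "i \<in> {..<height C - 1}" "x \<in> E i" for i x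
    using that column_map_level[OF C, of x i] by (auto simp: E_def c_def)
  show "column_map C ` A \<in> sets lebesgue"
    unfolding A_eq[symmetric]
    by (rule lebesgue_sets_image_piecewise_translation[OF _ disj E_sets translation]) auto
  show "emeasure lebesgue (column_map C ` A) \<le> emeasure lebesgue A"
    unfolding A_eq[symmetric]
    by (rule emeasure_lebesgue_image_piecewise_translation_le[OF _ disj E_sets translation]) auto
qed

lemma funpow_image_level:
  assumes f: "\<And>x. x \<in> nontop C \<Longrightarrow> f x = column_map C x"
    and C: "is_column C" and "i + q < height C"
  shows "(f ^^ q) ` level C i = level C (i + q)"
  using assms(3)
proof (induction q)
  case (Suc q)
  then have "(f ^^ Suc q) ` level C i = f ` level C (i + q)"
    by (simp flip: image_image)
  also have "\<dots> = column_map C ` level C (i + q)"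
    using Suc.prems by (intro image_cong refl f) (auto simp: in_nontop_iff)
  also have "\<dots> = level C (i + Suc q)"
    using column_map_image_level[OF C] Suc.prems by simp
  finally show ?case .
qed simp

definition inner_levels :: "column \<Rightarrow> real set \<Rightarrow> nat set" where
  "inner_levels C U = {i. i < height C \<and> level C i \<subseteq> U}"

lemma inner_levels_subset: "inner_levels C U \<subseteq> {..<height C}"
  by (auto simp: inner_levels_def)

lemma levels_inner_levels_subset: "levels C (inner_levels C U) \<subseteq> U"
  by (auto simp: inner_levels_def)

section \<open>Cutting and stacking one column\<close>

lemma atLeastLessThan_eq_UN_subintervals:
  fixes a d :: real
  assumes "0 < d"
  shows "{a..<a + real r * d} = (\<Union>k<r. {a + real k * d..<a + real k * d + d})"
proof (induction r)
  case (Suc r)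
  have "{a..<a + real (Suc r) * d} = {a..<a + real r * d} \<union> {a + real r * d..<a + real r * d + d}"
    using assms by (auto simp: ivl_disj_un distrib_right)
  then show ?case
    using Suc by (auto simp: lessThan_Suc)
qed simp

definition shift_overlap :: "int \<Rightarrow> int set \<Rightarrow> int set" where
  "shift_overlap a H = (\<lambda>h. a + h) ` H \<inter> H"

definition overlap_density :: "int \<Rightarrow> int set \<Rightarrow> real" where
  "overlap_density a H = real (card (shift_overlap a H)) / real (card H)"

locale column_cut =
  fixes C D :: column and r :: nat and s :: "nat \<Rightarrow> nat"
  assumes column_C: "is_column C" and column_D: "is_column D" and r_pos: "0 < r"
    and cut: "\<exists>sp. (\<forall>k<r. length (sp k) = s k) \<and> D = cut_and_stack C r sp"
begin

text \<open>Subcolumn \<open>k\<close> of \<open>C\<close> starts at height \<open>offset k\<close> of \<open>D\<close>.\<close>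

definition offset :: "nat \<Rightarrow> nat" where
  "offset k = (\<Sum>j<k. height C + s j)"

definition heights :: "int set" where
  "heights = (\<lambda>k. int (offset k)) ` {..<r}"

lemma offset_add_height_le:
  assumes "k < k'"
  shows "offset k + height C \<le> offset k'"
proof -
  have "offset (Suc k) \<le> offset k'"
    unfolding offset_def using assms by (intro sum_mono2) auto
  then show ?thesis by (simp add: offset_def)
qed

lemma inj_on_sublevel: "inj_on (\<lambda>(k, i). offset k + i) (UNIV \<times> {..<height C})"
proof (rule inj_onI, clarsimp)
  fix k i k' i' assume "i < height C" "i' < height C" "offset k + i = offset k' + i'"
  then show "k = k' \<and> i = i'"
    using offset_add_height_le[of k k'] offset_add_height_le[of k' k]
    by (cases k k' rule: linorder_cases) auto
qed

lemma width_D: "width D = width C / real r"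
  using cut by (auto simp: cut_and_stack_def)

lemma
  shows height_D: "height D = offset r"
    and left_end_D: "k < r \<Longrightarrow> i < height C \<Longrightarrow>
      left_ends D ! (offset k + i) = left_ends C ! i + real k * width D"
proof -
  obtain sp where sp: "\<And>k. k < r \<Longrightarrow> length (sp k) = s k" and D: "D = cut_and_stack C r sp"
    using cut by blast
  define f where "f = (\<lambda>k. subcolumn_ends C r k @ sp k)"
  have length_f: "length (f k) = height C + s k" if "k < r" for k
    using sp that by (simp add: f_def subcolumn_ends_def height_def)
  have left_ends_D: "left_ends D = concat (map f [0..<r])"
    by (simp add: D cut_and_stack_def f_def)
  have length_concat_f: "length (concat (map f [0..<k])) = offset k" if "k \<le> r" for k
    using that unfolding offset_def
    by (auto simp: length_concat comp_def length_f interv_sum_list_conv_sum_set_nat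
        atLeast0LessThan intro!: sum.cong)
  show "height D = offset r"
    using length_concat_f[of r] by (simp add: height_def left_ends_D)
  assume k: "k < r" and i: "i < height C"
  have "[0..<r] = [0..<k] @ k # [Suc k..<r]"
    using k by (metis less_imp_le_nat upt_add_eq_append upt_conv_Cons le_add_diff_inverse zero_le)
  then have "left_ends D ! (offset k + i) = f k ! i"
    using k i length_f[of k] length_concat_f[of k]
    by (simp add: left_ends_D nth_append del: length_concat)
  then show "left_ends D ! (offset k + i) = left_ends C ! i + real k * width D"
    using i by (simp add: f_def nth_append subcolumn_ends_def height_def width_D)
qed

lemma sublevel_less:
  assumes "k < r" "i < height C"
  shows "offset k + i < height D"
  using offset_add_height_le[OF assms(1)] assms(2) by (simp add: height_D)

lemma height_mult_le: "r * height C \<le> height D"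
proof -
  have "(\<Sum>j<r. height C) \<le> height D"
    unfolding height_D offset_def by (intro sum_mono) simp
  then show ?thesis by simp
qed

lemma level_eq_UN_sublevels:
  assumes "i < height C"
  shows "level C i = (\<Union>k<r. level D (offset k + i))"
proof -
  have "0 < width D" "width C = real r * width D"
    using column_D r_pos by (auto simp: is_column_def width_D)
  then show ?thesis
    using atLeastLessThan_eq_UN_subintervals[of "width D" "left_ends C ! i" r] assms
    by (simp add: level_def left_end_D)
qed

lemma sublevel_subset: "k < r \<Longrightarrow> i < height C \<Longrightarrow> level D (offset k + i) \<subseteq> level C i"
  using level_eq_UN_sublevels by blast

lemma in_sublevelE:
  assumes "x \<in> level C i" "i < height C"
  obtains k where "k < r" "x \<in> level D (offset k + i)"
  using assms level_eq_UN_sublevels by blast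

lemma levels_inner_levels_mono: "levels C (inner_levels C U) \<subseteq> levels D (inner_levels D U)"
proof
  fix x assume "x \<in> levels C (inner_levels C U)"
  then obtain i where i: "i < height C" "level C i \<subseteq> U" "x \<in> level C i"
    by (auto simp: inner_levels_def)
  then obtain k where "k < r" "x \<in> level D (offset k + i)"
    using in_sublevelE by blast
  then show "x \<in> levels D (inner_levels D U)"
    using i sublevel_subset sublevel_less unfolding inner_levels_def by blast
qed

lemma nontop_mono: "nontop C \<subseteq> nontop D"
proof
  fix x assume "x \<in> nontop C"
  then obtain i where i: "Suc i < height C" "x \<in> level C i"
    by (auto simp: in_nontop_iff)
  then obtain k where "k < r" "x \<in> level D (offset k + i)"
    using in_sublevelE Suc_lessD by blast
  then show "x \<in> nontop D"
    using sublevel_less[of k "Suc i"] i(1) unfolding in_nontop_iff by auto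
qed

lemma column_map_extends:
  assumes "x \<in> nontop C"
  shows "column_map D x = column_map C x"
proof -
  obtain i where i: "Suc i < height C" "x \<in> level C i"
    using assms by (auto simp: in_nontop_iff)
  then obtain k where k: "k < r" "x \<in> level D (offset k + i)"
    using in_sublevelE Suc_lessD by blast
  have "Suc (offset k + i) < height D"
    using sublevel_less[OF k(1) i(1)] by simp
  then show ?thesis
    using column_map_level[OF column_D k(2)] column_map_level[OF column_C i(2,1)]
      left_end_D[OF k(1), of i] left_end_D[OF k(1) i(1)] i(1) by simp
qed

lemma right_end_stable:
  assumes "x \<in> level C i" "i < height C" "x \<notin> nontop D"
  obtains j where "x \<in> level D j" "j < height D"
    "left_ends D ! j + width D = left_ends C ! i + width C"
proof -
  obtain k where k: "k < r" "x \<in> level D (offset k + i)"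
    using in_sublevelE assms by blast
  have top: "offset r \<le> Suc (offset k + i)"
    using assms(3) k(2) unfolding in_nontop_iff height_D[symmetric] by (meson not_less)
  have "r \<le> Suc k"
  proof (rule ccontr)
    assume "\<not> r \<le> Suc k"
    then have "offset (Suc k) + height C \<le> offset r"
      by (intro offset_add_height_le) simp
    then show False
      using offset_add_height_le[of k "Suc k"] top assms(2) by simp
  qed
  then have "r = Suc k"
    using k(1) by simp
  then have "width C = real k * width D + width D"
    by (simp add: width_D add_divide_distrib[symmetric] field_simps)
  then show ?thesis
    using k sublevel_less assms(2) left_end_D by (intro that[of "offset k + i"]) auto
qed

lemma inj_on_offset: "0 < height C \<Longrightarrow> inj_on (\<lambda>k. int (offset k)) K"
  using inj_onD[OF inj_on_sublevel, of "(_, 0)" "(_, 0)"] by (auto intro!: inj_onI)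

lemma card_heights: "0 < height C \<Longrightarrow> card heights = r"
  unfolding heights_def by (simp add: card_image inj_on_offset)

lemma height_le_of_shift_overlap:
  assumes "shift_overlap a heights \<noteq> {}" "0 < a"
  shows "int (height C) \<le> a"
proof -
  obtain k k' where shift: "int (offset k) = a + int (offset k')"
    using assms(1) by (auto simp: shift_overlap_def heights_def eq_commute)
  then have "k' < k"
    using assms(2) offset_add_height_le[of k k'] by (cases k k' rule: linorder_cases) auto
  from offset_add_height_le[OF this] shift show ?thesis by linarith
qed

definition overlap_sublevels :: "int \<Rightarrow> nat set \<Rightarrow> nat set" where
  "overlap_sublevels a I =
    (\<lambda>(k, i). offset k + i) ` ({k. k < r \<and> int (offset k) \<in> shift_overlap a heights} \<times> I)"

lemma overlap_sublevels_subset: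
  assumes "I \<subseteq> {..<height C}"
  shows "overlap_sublevels a I \<subseteq> {..<height D}"
  using assms sublevel_less by (auto simp: overlap_sublevels_def)

lemma measure_levels_overlap_sublevels:
  assumes I: "I \<subseteq> {..<height C}" and "0 < height C"
  shows "measure lebesgue (levels D (overlap_sublevels a I)) =
    overlap_density a heights * measure lebesgue (levels C I)"
proof -
  define K where "K = {k. k < r \<and> int (offset k) \<in> shift_overlap a heights}"
  have "shift_overlap a heights \<subseteq> heights"
    by (simp add: shift_overlap_def)
  then have "shift_overlap a heights = (\<lambda>k. int (offset k)) ` K"
    unfolding K_def heights_def by blast
  then have card_K: "card K = card (shift_overlap a heights)"
    using inj_on_offset[OF assms(2)] by (simp add: card_image)
  have "inj_on (\<lambda>(k, i). offset k + i) (K \<times> I)"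
    by (rule inj_on_subset[OF inj_on_sublevel]) (use I in auto)
  then have "card (overlap_sublevels a I) = card K * card I"
    by (simp add: overlap_sublevels_def K_def card_image card_cartesian_product)
  then show ?thesis
    using measure_levels[OF column_D overlap_sublevels_subset[OF I]] measure_levels[OF column_C I]
    by (simp add: overlap_density_def card_heights[OF assms(2)] card_K width_D)
qed

text \<open>If \<open>offset k = a + offset k'\<close> then \<open>f\<^sup>a\<close> carries subcolumn \<open>k'\<close> onto subcolumn \<open>k\<close>, level by
  level.\<close>

lemma levels_overlap_sublevels_subset:
  assumes f: "\<And>x. x \<in> nontop D \<Longrightarrow> f x = column_map D x"
    and I: "I \<subseteq> {..<height C}" and "0 \<le> a"
  shows "levels D (overlap_sublevels a I) \<subseteq> levels C I \<inter> (f ^^ nat a) ` levels C I"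
proof
  fix x assume "x \<in> levels D (overlap_sublevels a I)"
  then obtain k k' i where k: "k < r" and k': "k' < r"
    and shift: "int (offset k) = a + int (offset k')"
    and i: "i \<in> I" and x: "x \<in> level D (offset k + i)"
    by (auto simp: overlap_sublevels_def shift_overlap_def heights_def)
  have piece: "level D (offset l + i) \<subseteq> levels C I" if "l < r" for l
    using sublevel_subset[OF that] i I by blast
  have "offset k + i = (offset k' + i) + nat a"
    using shift \<open>0 \<le> a\<close> by linarith
  moreover have "offset k + i < height D"
    using sublevel_less[OF k] i I by blast
  ultimately have "(f ^^ nat a) ` level D (offset k' + i) = level D (offset k + i)"
    using funpow_image_level[OF f column_D, of "offset k' + i" "nat a"] by (simp add: ac_simps)
  then show "x \<in> levels C I \<inter> (f ^^ nat a) ` levels C I"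
    using x piece[OF k] piece[OF k'] by blast
qed

end

section \<open>Rank-one transformations\<close>

context rank_one
begin

abbreviation X :: "real set" where "X \<equiv> rank_one_space C"
abbreviation T :: "real \<Rightarrow> real" where "T \<equiv> rank_one_map C"
abbreviation M :: "real measure" where "M \<equiv> lebesgue_on X"
abbreviation h :: "nat \<Rightarrow> nat" where "h n \<equiv> height (C n)"
abbreviation w :: "nat \<Rightarrow> real" where "w n \<equiv> width (C n)"

sublocale cutting: column_cut "C n" "C (Suc n)" "r n" "s n" for n
  using columns cuts[of n] C_Suc by unfold_locales auto

lemma width_pos: "0 < w n"
  using columns[of n] by (simp add: is_column_def)

lemma height_pos: "0 < h n"
proof (induction n)
  case 0
  then show ?case by (simp add: C_0 height_def)
next
  case (Suc n)
  then have "0 < r n * h n"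
    using cutting.r_pos by simp
  also note cutting.height_mult_le
  finally show ?case .
qed

lemma strict_mono_height: "strict_mono h"
proof (rule strict_mono_Suc_iff[THEN iffD2], intro allI)
  fix n
  have "2 * h n \<le> r n * h n"
    using cuts by simp
  also note cutting.height_mult_le
  finally show "h n < h (Suc n)"
    using height_pos[of n] by simp
qed

lemma width_le: "w n \<le> (1/2) ^ n"
proof (induction n)
  case 0
  then show ?case by (simp add: C_0)
next
  case (Suc n)
  have "w (Suc n) \<le> w n / 2"
    unfolding cutting.width_D using cuts[of n] width_pos[of n] by (intro divide_left_mono) auto
  then show ?case using Suc by simp
qed

lemma width_tendsto_0: "w \<longlonglongrightarrow> 0"
proof (rule tendsto_sandwich[OF _ _ tendsto_const])
  show "(\<lambda>n. (1/2::real) ^ n) \<longlonglongrightarrow> 0" by (simp add: LIMSEQ_realpow_zero)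
qed (auto simp: width_le width_pos less_imp_le)

lemma incseq_nontop: "incseq (\<lambda>n. nontop (C n))"
  by (rule incseq_SucI) (rule cutting.nontop_mono)

lemma rank_one_map_nontop:
  assumes "x \<in> nontop (C n)"
  shows "T x = column_map (C n) x"
proof -
  have "column_map (C m) x = column_map (C n) x" if "n \<le> m" for m
    using that
  proof (induction m rule: dec_induct)
    case (step m)
    have "x \<in> nontop (C m)"
      using assms incseqD[OF incseq_nontop step(1)] by blast
    then show ?case
      using step.IH cutting.column_map_extends by simp
  qed simp
  then have "(\<lambda>m. column_map (C m) x) \<longlonglongrightarrow> column_map (C n) x"
    by (intro tendsto_eventually eventually_sequentiallyI)
  then show ?thesis
    unfolding rank_one_map_def by (rule limI)
qed

text \<open>A point outside all \<open>nontop (C n)\<close> would keep the distance to a fixed right endpoint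
  below every \<open>w n\<close>.\<close>

lemma Union_nontop: "(\<Union>n. nontop (C n)) = X"
proof
  show "(\<Union>n. nontop (C n)) \<subseteq> X"
    by (fastforce simp: rank_one_space_def in_nontop_iff)
  show "X \<subseteq> (\<Union>n. nontop (C n))"
  proof (rule subsetI, rule ccontr)
    fix x assume "x \<in> X" and not: "x \<notin> (\<Union>n. nontop (C n))"
    then obtain n i where i: "x \<in> level (C n) i" "i < h n"
      by (auto simp: rank_one_space_def)
    define R where "R = left_ends (C n) ! i + w n"
    have same_end: "\<exists>j<h m. x \<in> level (C m) j \<and> left_ends (C m) ! j + w m = R" if "n \<le> m" for m
      using that
    proof (induction m rule: dec_induct)
      case base
      then show ?case using i by (auto simp: R_def)
    next
      case (step m)
      then obtain j where j: "x \<in> level (C m) j" "j < h m" and R: "left_ends (C m) ! j + w m = R"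
        by blast
      have "x \<notin> nontop (C (Suc m))"
        using not by blast
      from cutting.right_end_stable[OF j this] show ?case
        using R by metis
    qed
    have "R - x \<le> w m" if "n \<le> m" for m
      using same_end[OF that] by (auto simp: level_def)
    then have "R - x \<le> 0"
      by (intro LIMSEQ_le_const[OF width_tendsto_0]) auto
    then show False
      using i(1) by (simp add: R_def level_def)
  qed
qed

lemma sets_lebesgue_nontop: "nontop (C n) \<in> sets lebesgue"
  by (simp add: nontop_def)

lemma sets_lebesgue_rank_one_space: "X \<in> sets lebesgue"
  unfolding Union_nontop[symmetric] by (intro sets.countable_UN) (auto simp: sets_lebesgue_nontop)

lemma sets_M_iff: "A \<in> sets M \<longleftrightarrow> A \<in> sets lebesgue \<and> A \<subseteq> X"
  using sets_restrict_space_iff[of X lebesgue A] sets_lebesgue_rank_one_space by auto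

lemma emeasure_M: "A \<subseteq> X \<Longrightarrow> emeasure M A = emeasure lebesgue A"
  using sets_lebesgue_rank_one_space by (intro emeasure_restrict_space) auto

lemma measure_M: "A \<subseteq> X \<Longrightarrow> measure M A = measure lebesgue A"
  by (simp add: measure_def emeasure_M)

lemma levels_subset_space: "I \<subseteq> {..<h n} \<Longrightarrow> levels (C n) I \<subseteq> X"
  by (auto simp: rank_one_space_def)

lemma fmeasurable_levels:
  assumes "I \<subseteq> {..<h n}"
  shows "levels (C n) I \<in> fmeasurable M"
proof -
  have "levels (C n) I \<in> lmeasurable"
    using finite_subset[OF assms] by (intro lmeasurable_levels) simp
  then show ?thesis
    using levels_subset_space[OF assms] by (simp add: fmeasurable_def sets_M_iff emeasure_M)
qed

lemma measure_nonexpanding_rank_one_map: "measure_nonexpanding M T"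
proof (rule measure_nonexpanding_incseq[OF incseq_nontop])
  show "nontop (C n) \<in> sets M" for n
    using Union_nontop by (auto simp: sets_M_iff sets_lebesgue_nontop)
  show "(\<Union>n. nontop (C n)) = space M"
    using sets_lebesgue_rank_one_space by (simp add: Union_nontop space_restrict_space)
  fix n A assume "A \<in> sets M" and A: "A \<subseteq> nontop (C n)"
  then have sets: "A \<in> sets lebesgue"
    by (simp add: sets_M_iff)
  have image_eq: "T ` A = column_map (C n) ` A"
    using A by (intro image_cong refl rank_one_map_nontop) auto
  have "T ` A \<subseteq> X"
    using column_map_image_nontop_subset[OF columns, of n] A levels_subset_space[of "{..<h n}" n]
    unfolding image_eq by blast
  then show "T ` A \<in> sets M \<and> emeasure M (T ` A) \<le> emeasure M A"
    using sets_lebesgue_column_map_image[OF columns sets A]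
      emeasure_lebesgue_column_map_image_le[OF columns sets A] \<open>A \<in> sets M\<close>
    by (simp add: image_eq sets_M_iff emeasure_M)
qed

lemma UN_inner_levels:
  assumes "open U"
  shows "(\<Union>n. levels (C n) (inner_levels (C n) U)) = X \<inter> U"
proof
  show "(\<Union>n. levels (C n) (inner_levels (C n) U)) \<subseteq> X \<inter> U"
    by (auto simp: rank_one_space_def inner_levels_def)
  show "X \<inter> U \<subseteq> (\<Union>n. levels (C n) (inner_levels (C n) U))"
  proof
    fix x assume x: "x \<in> X \<inter> U"
    then obtain n where n: "x \<in> nontop (C n)"
      using Union_nontop by blast
    obtain d where d: "0 < d" "ball x d \<subseteq> U"
      using assms x by (auto elim: openE)
    have "\<forall>\<^sub>F m in sequentially. w m < d \<and> n \<le> m"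
      using order_tendstoD(2)[OF width_tendsto_0 d(1)] eventually_ge_at_top[of n]
      by (rule eventually_conj)
    then obtain m where m: "w m < d" "n \<le> m"
      using eventually_happens by force
    obtain j where j: "Suc j < h m" "x \<in> level (C m) j"
      using incseqD[OF incseq_nontop m(2)] n in_nontop_iff by blast
    have "level (C m) j \<subseteq> ball x d"
      using j(2) m(1) by (auto simp: level_def dist_real_def)
    then show "x \<in> (\<Union>n. levels (C n) (inner_levels (C n) U))"
      using Suc_lessD[OF j(1)] j(2) d(2) unfolding inner_levels_def by blast
  qed
qed

lemma fmeasurable_approx_by_levels:
  assumes A: "A \<in> fmeasurable M" and "0 < \<epsilon>"
  obtains I where "\<And>n. I n \<subseteq> {..<h n}"
    "\<And>n. measure M (levels (C n) (I n) - A) \<le> \<epsilon>"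
    "(\<lambda>n. measure M (A \<inter> levels (C n) (I n))) \<longlonglongrightarrow> measure M A"
proof -
  have A_leb: "A \<in> sets lebesgue" "A \<subseteq> X"
    using fmeasurableD[OF A] by (auto simp: sets_M_iff)
  obtain U where U: "open U" "A \<subseteq> U" "U - A \<in> lmeasurable" "emeasure lebesgue (U - A) < ennreal \<epsilon>"
    using sets_lebesgue_outer_open[OF A_leb(1) \<open>0 < \<epsilon>\<close>] by blast
  define B where "B n = levels (C n) (inner_levels (C n) U)" for n
  have B_X: "B n \<subseteq> X" for n
    unfolding B_def by (rule levels_subset_space[OF inner_levels_subset])
  have B_sets: "B n \<in> sets lebesgue" for n
    unfolding B_def by (rule sets_lebesgue_levels)
  have excess: "measure M (B n - A) \<le> \<epsilon>" for n
  proof -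
    have "B n - A \<subseteq> U - A"
      unfolding B_def by (intro Diff_mono levels_inner_levels_subset subset_refl)
    have "measure M (B n - A) = measure lebesgue (B n - A)"
      using B_X[of n] by (intro measure_M) blast
    also have "\<dots> \<le> measure lebesgue (U - A)"
      using \<open>B n - A \<subseteq> U - A\<close> sets.Diff[OF B_sets A_leb(1)] U(3)
      by (rule measure_mono_fmeasurable)
    also have "\<dots> \<le> \<epsilon>"
      using U(4) \<open>0 < \<epsilon>\<close> unfolding measure_def by (intro enn2real_leI) auto
    finally show ?thesis .
  qed
  have exhaust: "(\<lambda>n. measure M (A \<inter> B n)) \<longlonglongrightarrow> measure M A"
  proof (rule Lim_measure_Int_incseq[OF A])
    show "incseq B"
      unfolding B_def by (rule incseq_SucI) (rule cutting.levels_inner_levels_mono)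
    show "B n \<in> sets M" for n
      using B_sets B_X by (simp add: sets_M_iff)
    show "A \<subseteq> (\<Union>n. B n)"
      unfolding B_def UN_inner_levels[OF U(1)] using A_leb(2) U(2) by (rule Int_greatest)
  qed
  show ?thesis
    using inner_levels_subset excess exhaust unfolding B_def by (rule that)
qed

lemma height_set_eq_heights: "height_set r s C n = cutting.heights n"
proof -
  have sum_eq: "(\<Sum>k=0..l. int (h n) + int (s n k)) = int (cutting.offset n (Suc l))" for l
    by (simp add: cutting.offset_def atLeast0AtMost lessThan_Suc_atMost)
  have "height_set r s C n =
      insert (int (cutting.offset n 0)) ((\<lambda>l. int (cutting.offset n (Suc l))) ` {..<r n - 1})"
    unfolding height_set_def sum_eq by (auto simp: cutting.offset_def[of n 0])
  also have "\<dots> = (\<lambda>k. int (cutting.offset n k)) ` insert 0 (Suc ` {..<r n - 1})"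
    by (simp add: image_image)
  also have "insert 0 (Suc ` {..<r n - 1}) = {..<r n}"
    using cutting.r_pos[of n] by (simp flip: lessThan_Suc_eq_insert_0)
  finally show ?thesis
    by (simp add: cutting.heights_def)
qed

lemma measure_levels_Int_funpow_image_ge:
  assumes I: "I \<subseteq> {..<h n}" and "0 \<le> a"
  shows "overlap_density a (height_set r s C n) * measure M (levels (C n) I)
    \<le> measure M (levels (C n) I \<inter> (T ^^ nat a) ` levels (C n) I)"
proof -
  let ?B = "levels (C n) I" and ?J = "cutting.overlap_sublevels n a I"
  have J: "levels (C (Suc n)) ?J \<subseteq> X"
    by (rule levels_subset_space[OF cutting.overlap_sublevels_subset[OF I]])
  have "overlap_density a (height_set r s C n) * measure M ?B = measure M (levels (C (Suc n)) ?J)"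
    using cutting.measure_levels_overlap_sublevels[OF I height_pos]
    by (simp add: height_set_eq_heights measure_M J levels_subset_space[OF I])
  also have "\<dots> \<le> measure M (?B \<inter> (T ^^ nat a) ` ?B)"
  proof (rule measure_mono_fmeasurable)
    show "levels (C (Suc n)) ?J \<subseteq> ?B \<inter> (T ^^ nat a) ` ?B"
      using rank_one_map_nontop I \<open>0 \<le> a\<close> by (rule cutting.levels_overlap_sublevels_subset)
    show "levels (C (Suc n)) ?J \<in> sets M"
      using J by (simp add: sets_M_iff)
    show "?B \<inter> (T ^^ nat a) ` ?B \<in> fmeasurable M"
      using measure_nonexpanding_funpow[OF measure_nonexpanding_rank_one_map] fmeasurable_levels[OF I]
      by (intro fmeasurable.Int measure_nonexpanding_image_fmeasurable)
  qed
  finally show ?thesis .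
qed

lemma filterlim_shift_at_top:
  assumes n: "filterlim n at_top F" and pos: "\<And>m. 0 < a m"
    and density: "((\<lambda>m. overlap_density (a m) (height_set r s C (n m))) \<longlongrightarrow> \<rho>) F" and "0 < \<rho>"
  shows "filterlim a at_top F"
proof (rule filterlim_at_top_mono)
  show "filterlim (\<lambda>m. int (h (n m))) at_top F"
    by (rule filterlim_compose[OF filterlim_int_sequentially
          filterlim_compose[OF filterlim_subseq[OF strict_mono_height] n]])
  show "\<forall>\<^sub>F m in F. int (h (n m)) \<le> a m"
    using order_tendstoD(1)[OF density \<open>0 < \<rho>\<close>]
  proof eventually_elim
    case (elim m)
    then have "shift_overlap (a m) (cutting.heights (n m)) \<noteq> {}"
      by (auto simp: overlap_density_def height_set_eq_heights)
    then show ?case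
      using pos by (rule cutting.height_le_of_shift_overlap)
  qed
qed

lemma eventually_measure_Int_power_image_gt:
  assumes n: "filterlim n at_top F" and pos: "\<And>m. 0 < a m"
    and density: "((\<lambda>m. overlap_density (a m) (height_set r s C (n m))) \<longlongrightarrow> \<rho>) F"
    and A: "A \<in> fmeasurable M" and b: "b < \<rho> * measure M A"
  shows "\<forall>\<^sub>F m in F. b < measure M (A \<inter> power_image M T (a m) A)"
proof -
  define \<epsilon> where "\<epsilon> = (\<rho> * measure M A - b) / 4"
  have "0 < \<epsilon>"
    using b by (simp add: \<epsilon>_def)
  then obtain I where I: "\<And>n. I n \<subseteq> {..<h n}"
    and excess: "\<And>n. measure M (levels (C n) (I n) - A) \<le> \<epsilon>"
    and exhaust: "(\<lambda>n. measure M (A \<inter> levels (C n) (I n))) \<longlonglongrightarrow> measure M A"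
    using fmeasurable_approx_by_levels[OF A] by blast
  define B where "B m = levels (C (n m)) (I (n m))" for m
  have "\<forall>\<^sub>F m in F. b < measure M (A \<inter> (T ^^ nat (a m)) ` A)"
  proof (rule eventually_measure_Int_image_gt)
    show "measure_nonexpanding M (T ^^ nat (a m))" for m
      by (rule measure_nonexpanding_funpow[OF measure_nonexpanding_rank_one_map])
    show "B m \<in> fmeasurable M" for m
      unfolding B_def using I by (rule fmeasurable_levels)
    show "measure M (B m - A) \<le> \<epsilon>" for m
      unfolding B_def by (rule excess)
    show "((\<lambda>m. measure M (A \<inter> B m)) \<longlongrightarrow> measure M A) F"
      unfolding B_def by (rule filterlim_compose[OF exhaust n])
    show "overlap_density (a m) (height_set r s C (n m)) * measure M (B m)
        \<le> measure M (B m \<inter> (T ^^ nat (a m)) ` B m)" for m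
      unfolding B_def using I less_imp_le[OF pos] by (rule measure_levels_Int_funpow_image_ge)
    show "b + 2 * \<epsilon> < \<rho> * measure M A"
      using b by (simp add: \<epsilon>_def field_simps)
  qed (use A density in \<open>auto simp: overlap_density_def\<close>)
  then show ?thesis
    using pos by (simp add: power_image_def less_imp_le)
qed

end

theorem proposition5p1:
  fixes r :: "nat \<Rightarrow> nat" and s :: "nat \<Rightarrow> nat \<Rightarrow> nat" and C :: "nat \<Rightarrow> column"
    and n :: "nat \<Rightarrow> nat" and a :: "nat \<Rightarrow> int" and \<rho> :: real
  assumes "rank_one r s C"
    and "emeasure lebesgue (rank_one_space C) = \<infinity>"
    and "0 < \<rho>" and "\<rho> \<le> 1"
    and "filterlim n at_top sequentially"
    and "\<And>m. a (n m) > 0"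
    and "(\<lambda>m. real (card ((\<lambda>h. a (n m) + h) ` height_set r s C (n m) \<inter> height_set r s C (n m)))
               / real (card (height_set r s C (n m)))) \<longlonglongrightarrow> \<rho>"
  shows "at_least_partially_rigid (lebesgue_on (rank_one_space C)) (rank_one_map C) \<rho>"
proof -
  interpret rank_one r s C by fact
  have density: "(\<lambda>m. overlap_density (a (n m)) (height_set r s C (n m))) \<longlonglongrightarrow> \<rho>"
    using assms(7) by (simp add: overlap_density_def shift_overlap_def)
  show ?thesis
  proof (rule at_least_partially_rigidI)
    show "filterlim (\<lambda>m. a (n m)) at_top sequentially"
      using assms(5,6) density \<open>0 < \<rho>\<close> by (rule filterlim_shift_at_top)
    show "\<forall>\<^sub>F m in sequentially. b < measure M (A \<inter> power_image M T (a (n m)) A)"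
      if "A \<in> fmeasurable M" "b < \<rho> * measure M A" for A b
      using assms(5,6) density that by (rule eventually_measure_Int_power_image_gt)
  qed
qed

end
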